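(* Let $m\ge 2$, $n\ge 2$, $N=\{1,\dots,n\}$, and let $\mathcal{A}=(a_{i_1\cdots i_m})\in\mathbb{C}^{[m,n]}$ be a complex tensor of order $m$ and dimension $n$. For $i,j,p\in N$ with $j\neq i$, $p\ne i$, put $$\mathcal{K}_{ij}(\mathcal{A})=\left\{z\in\mathbb{C}: \left(|z-a_{i\cdots i}|-r_i^j(\mathcal{A})\right)|z-a_{j\cdots j}|\le |a_{ij\cdots j}|\,r_j(\mathcal{A})\right\},$$ $$\Lambda_{ip}(\mathcal{A})=\left\{z\in\mathbb{C}: \left(|z-a_{i\cdots i}|+r_i^p(\mathcal{A})\right)|z-a_{p\cdots p}|<|a_{ip\cdots p}|\left(2|a_{pi\cdots i}|-r_p(\mathcal{A})\right)\right\},$$ $$\Lambda_i(\mathcal{A})=\bigcup_{p\in N,\,p\neq i}\Lambda_{ip}(\mathcal{A}),\qquad \Theta_{ij}(\mathcal{A})=\mathcal{K}_{ij}(\mathcal{A})\setminus\Lambda_i(\mathcal{A}).$$ Then $$\sigma(\mathcal{A})\subseteq\Theta(\mathcal{A}):=\bigcup_{i,j\in N,\ j\neq i}\Theta_{ij}(\mathcal{A}).$$ Furthermore, $\Theta(\mathcal{A})\subseteq\mathcal{K}(\mathcal{A}):=\bigcup_{i,j\in N,\ j\ne i}\mathcal{K}_{ij}(\mathcal{A})$.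
   Context: A tensor $\mathcal{A}=(a_{i_1\cdots i_m})\in\mathbb{C}^{[m,n]}$ of order $m$ and dimension $n$ is a family of complex numbers $a_{i_1\cdots i_m}$ indexed by $(i_1,\dots,i_m)\in N^m$, $N=\{1,\dots,n\}$. The entry $a_{j i\cdots i}$ is the one with first index $j$ and the remaining $m-1$ indices equal to $i$; $a_{i\cdots i}$ has all $m$ indices equal to $i$. For $x\in\mathbb{C}^n$, $\mathcal{A}x^{m-1}\in\mathbb{C}^n$ is given by $(\mathcal{A}x^{m-1})_i=\sum_{i_2,\dots,i_m\in N}a_{ii_2\cdots i_m}x_{i_2}\cdots x_{i_m}$, and $x^{[m-1]}=(x_1^{m-1},\dots,x_n^{m-1})^T$. A number $\lambda\in\mathbb{C}$ is an eigenvalue of $\mathcal{A}$ if there is a nonzero $x\in\mathbb{C}^n$ with $\mathcal{A}x^{m-1}=\lambda x^{[m-1]}$; $\sigma(\mathcal{A})$ is the set of all eigenvalues of $\mathcal{A}$. For $i\in N$, $r_i(\mathcal{A})=\sum |a_{ii_2\cdots i_m}|$, the sum being over all $(i_2,\dots,i_m)\in N^{m-1}$ with $(i_2,\dots,i_m)\neq(i,\dots,i)$. For $j\ne i$, $r_i^j(\mathcal{A})=r_i(\mathcal{A})-|a_{ij\cdots j}|$, i.e. the same sum with the term $(i_2,\dots,i_m)=(j,\dots,j)$ also omitted. *)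

theory Defs
  imports "HOL-Analysis.Analysis"
begin

text \<open>
  The index set \<open>N = {1,\<dots>,n}\<close> is the finite type \<open>'n\<close>, with \<open>n = CARD('n)\<close>.  A tensor of order
  \<open>m\<close> is a function on index lists \<open>[i\<^sub>1, \<dots>, i\<^sub>m]\<close>.  Values on lists whose length is not \<open>m\<close> carry
  no meaning, and for \<open>m \<ge> 1\<close> no definition below uses them.
\<close>

type_synonym 'n tensor = "'n list \<Rightarrow> complex"

text \<open>The tails \<open>[i\<^sub>2, \<dots>, i\<^sub>m]\<close> of the index lists of a tensor of order \<open>m\<close>.\<close>

definition tails :: "nat \<Rightarrow> 'n::finite list set" where
  "tails m = {js. length js = m - 1}"

definition diag_entry :: "nat \<Rightarrow> 'n::finite tensor \<Rightarrow> 'n \<Rightarrow> complex" where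
  "diag_entry m A i = A (replicate m i)"

text \<open>The entry \<open>a\<^bsub>j i \<dots> i\<^esub>\<close>, with first index \<open>j\<close> and all the others equal to \<open>i\<close>.\<close>

definition pair_entry :: "nat \<Rightarrow> 'n::finite tensor \<Rightarrow> 'n \<Rightarrow> 'n \<Rightarrow> complex" where
  "pair_entry m A j i = A (j # replicate (m - 1) i)"

definition tensor_apply :: "nat \<Rightarrow> 'n::finite tensor \<Rightarrow> complex ^ 'n \<Rightarrow> complex ^ 'n" where
  "tensor_apply m A x = (\<chi> i. \<Sum>js\<in>tails m. A (i # js) * prod_list (map (\<lambda>j. x $ j) js))"

definition vec_power :: "complex ^ 'n::finite \<Rightarrow> nat \<Rightarrow> complex ^ 'n" where
  "vec_power x k = (\<chi> i. (x $ i) ^ k)"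

definition tensor_eigenvalue :: "nat \<Rightarrow> 'n::finite tensor \<Rightarrow> complex \<Rightarrow> bool" where
  "tensor_eigenvalue m A z \<longleftrightarrow>
     (\<exists>x. x \<noteq> 0 \<and> tensor_apply m A x = z *s vec_power x (m - 1))"

definition tensor_spectrum :: "nat \<Rightarrow> 'n::finite tensor \<Rightarrow> complex set" where
  "tensor_spectrum m A = {z. tensor_eigenvalue m A z}"

definition row_sum :: "nat \<Rightarrow> 'n::finite tensor \<Rightarrow> 'n \<Rightarrow> real" where
  "row_sum m A i = (\<Sum>js\<in>tails m - {replicate (m - 1) i}. cmod (A (i # js)))"

definition row_sum_except :: "nat \<Rightarrow> 'n::finite tensor \<Rightarrow> 'n \<Rightarrow> 'n \<Rightarrow> real" where
  "row_sum_except m A i j = row_sum m A i - cmod (pair_entry m A i j)"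

definition K_set :: "nat \<Rightarrow> 'n::finite tensor \<Rightarrow> 'n \<Rightarrow> 'n \<Rightarrow> complex set" where
  "K_set m A i j =
     {z. (cmod (z - diag_entry m A i) - row_sum_except m A i j) * cmod (z - diag_entry m A j)
           \<le> cmod (pair_entry m A i j) * row_sum m A j}"

definition Lambda_pair :: "nat \<Rightarrow> 'n::finite tensor \<Rightarrow> 'n \<Rightarrow> 'n \<Rightarrow> complex set" where
  "Lambda_pair m A i p =
     {z. (cmod (z - diag_entry m A i) + row_sum_except m A i p) * cmod (z - diag_entry m A p)
           < cmod (pair_entry m A i p) * (2 * cmod (pair_entry m A p i) - row_sum m A p)}"

definition Lambda_set :: "nat \<Rightarrow> 'n::finite tensor \<Rightarrow> 'n \<Rightarrow> complex set" where
  "Lambda_set m A i = (\<Union>p\<in>{p. p \<noteq> i}. Lambda_pair m A i p)"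

definition Theta_pair :: "nat \<Rightarrow> 'n::finite tensor \<Rightarrow> 'n \<Rightarrow> 'n \<Rightarrow> complex set" where
  "Theta_pair m A i j = K_set m A i j - Lambda_set m A i"

definition Theta_region :: "nat \<Rightarrow> 'n::finite tensor \<Rightarrow> complex set" where
  "Theta_region m A = (\<Union>i. \<Union>j\<in>{j. j \<noteq> i}. Theta_pair m A i j)"

definition K_region :: "nat \<Rightarrow> 'n::finite tensor \<Rightarrow> complex set" where
  "K_region m A = (\<Union>i. \<Union>j\<in>{j. j \<noteq> i}. K_set m A i j)"

end

theory Submission
  imports Defs
begin

text \<open>
  Let \<open>x\<close> be an eigenvector for \<open>z\<close>, let \<open>t\<close> be an index at which \<open>\<bar>x\<^sub>t\<bar>\<close> is maximal, and write
  \<open>X = \<bar>x\<^sub>t\<bar>\<^sup>m\<^sup>-\<^sup>1 > 0\<close>.  Keep only the two pure-power terms with indices \<open>t\<close> and \<open>p\<close> of the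
  eigenvalue equation, in row \<open>t\<close> and again in row \<open>p\<close>.  By maximality the remaining terms of row
  \<open>t\<close> add up to at most \<open>r\<^sub>t\<^sup>p X\<close> in modulus, and those of row \<open>p\<close> to at most \<open>r\<^sub>p\<^sup>t X\<close>
  (lemma \<open>eigenvector_two_term_bound\<close>).

  The triangle inequality reads each of these two estimates in two directions.  Solving for the
  diagonal terms gives upper bounds for \<open>\<bar>z - a\<^sub>t\<^sub>\<dots>\<^sub>t\<bar> X\<close> and
  \<open>\<bar>z - a\<^sub>p\<^sub>\<dots>\<^sub>p\<bar> \<bar>x\<^sub>p\<bar>\<^sup>m\<^sup>-\<^sup>1\<close>, and eliminating \<open>\<bar>x\<^sub>p\<bar>\<^sup>m\<^sup>-\<^sup>1\<close> between them puts \<open>z\<close> into \<open>\<K>\<^sub>t\<^sub>p\<close>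
  (lemma \<open>K_set_of_maximal_index\<close>).  Solving for the off-diagonal terms gives upper
  bounds for \<open>\<bar>a\<^sub>t\<^sub>p\<^sub>\<dots>\<^sub>p\<bar> \<bar>x\<^sub>p\<bar>\<^sup>m\<^sup>-\<^sup>1\<close> and \<open>\<bar>a\<^sub>p\<^sub>t\<^sub>\<dots>\<^sub>t\<bar> X\<close>, and the same elimination keeps \<open>z\<close> out of
  \<open>\<Lambda>\<^sub>t\<^sub>p\<close> (lemma \<open>not_Lambda_pair_of_maximal_index\<close>).  Both conclusions hold for the same \<open>t\<close>
  and for every \<open>p \<noteq> t\<close>, so \<open>z\<close> lies in \<open>\<Theta>\<^sub>t\<^sub>j\<close> as soon as some \<open>j \<noteq> t\<close> exists.
\<close>

lemma finite_tails: "finite (tails m :: 'n::finite list set)"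
  using finite_lists_length_eq[of "UNIV :: 'n set" "m - 1"] by (simp add: tails_def)

lemma replicate_in_tails: "replicate (m - 1) i \<in> tails m"
  by (simp add: tails_def)

lemma diag_entry_Cons: "m \<ge> 1 \<Longrightarrow> diag_entry m A i = A (i # replicate (m - 1) i)"
  by (cases m) (simp_all add: diag_entry_def)

lemma replicate_in_tails_Diff:
  "m \<ge> 2 \<Longrightarrow> j \<noteq> i \<Longrightarrow> replicate (m - 1) j \<in> tails m - {replicate (m - 1) i}"
  by (auto simp: tails_def)

lemma row_sum_except_eq_sum:
  assumes "m \<ge> 2" and "j \<noteq> i"
  shows "row_sum_except m A i j =
    (\<Sum>js\<in>tails m - {replicate (m - 1) i} - {replicate (m - 1) j}. cmod (A (i # js)))"
proof -
  have "replicate (m - 1) j \<in> tails m - {replicate (m - 1) i}"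
    using assms by (rule replicate_in_tails_Diff)
  then show ?thesis
    by (simp add: row_sum_except_def row_sum_def pair_entry_def finite_tails
        sum.remove[of _ "replicate (m - 1) j"])
qed

lemma norm_prod_list_map_le:
  fixes f :: "'a \<Rightarrow> complex"
  assumes "\<And>j. cmod (f j) \<le> M"
  shows "cmod (prod_list (map f js)) \<le> M ^ length js"
proof (induction js)
  case (Cons j js)
  have "0 \<le> M"
    using assms[of j] norm_ge_zero[of "f j"] by linarith
  with Cons assms[of j] show ?case
    by (simp add: norm_mult mult_mono)
qed simp

text \<open>
  Separating the \<open>l\<close>-th pure power from the rest of row \<open>k\<close> gives the estimate in a form that can
  be solved for either of the two retained terms.
\<close>

lemma eigenvector_two_term_bound:
  fixes x :: "complex ^ 'n::finite"
  assumes m: "m \<ge> 2" and "l \<noteq> k"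
    and eig: "tensor_apply m A x = z *s vec_power x (m - 1)"
    and max: "\<And>j. cmod (x $ j) \<le> M"
  shows "cmod ((z - diag_entry m A k) * (x $ k) ^ (m - 1) - pair_entry m A k l * (x $ l) ^ (m - 1))
    \<le> row_sum_except m A k l * M ^ (m - 1)"
proof -
  let ?f = "\<lambda>js. A (k # js) * prod_list (map (\<lambda>j. x $ j) js)"
  let ?k = "replicate (m - 1) k" and ?l = "replicate (m - 1) l"
  let ?R = "tails m - {?k} - {?l}"
  have l: "?l \<in> tails m - {?k}"
    using assms(1,2) by (rule replicate_in_tails_Diff)
  have "z * (x $ k) ^ (m - 1) = sum ?f (tails m)"
    using arg_cong[OF eig, of "\<lambda>v. v $ k"] by (simp add: tensor_apply_def vec_power_def)
  also have "\<dots> = ?f ?k + (?f ?l + sum ?f ?R)"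
    by (simp only: sum.remove[OF finite_tails replicate_in_tails[of m k]]
        sum.remove[OF finite_Diff[OF finite_tails] l])
  also have "\<dots> = diag_entry m A k * (x $ k) ^ (m - 1) + (pair_entry m A k l * (x $ l) ^ (m - 1)
      + sum ?f ?R)"
    using m by (simp add: diag_entry_Cons pair_entry_def prod_list_replicate)
  finally have "(z - diag_entry m A k) * (x $ k) ^ (m - 1) - pair_entry m A k l * (x $ l) ^ (m - 1)
      = sum ?f ?R"
    by (simp add: algebra_simps)
  also have "cmod \<dots> \<le> (\<Sum>js\<in>?R. cmod (A (k # js)) * M ^ (m - 1))"
  proof (rule sum_norm_le)
    fix js assume "js \<in> ?R"
    then have "length js = m - 1"
      by (simp add: tails_def)
    with norm_prod_list_map_le[of "\<lambda>j. x $ j" M js] max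
    show "cmod (?f js) \<le> cmod (A (k # js)) * M ^ (m - 1)"
      by (simp add: norm_mult mult_left_mono)
  qed
  also have "\<dots> = row_sum_except m A k l * M ^ (m - 1)"
    using assms(1,2) by (simp add: row_sum_except_eq_sum sum_distrib_right)
  finally show ?thesis .
qed

text \<open>
  Solving row \<open>t\<close> for its diagonal term produces a multiple of \<open>\<bar>x\<^sub>p\<bar>\<^sup>m\<^sup>-\<^sup>1\<close>; multiplying by
  \<open>\<bar>z - a\<^sub>p\<^sub>\<dots>\<^sub>p\<bar>\<close> turns this into a quantity that row \<open>p\<close> bounds by \<open>r\<^sub>p \<bar>x\<^sub>t\<bar>\<^sup>m\<^sup>-\<^sup>1\<close>.
\<close>

lemma K_set_of_maximal_index:
  fixes x :: "complex ^ 'n::finite"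
  assumes m: "m \<ge> 2" and pt: "p \<noteq> t"
    and eig: "tensor_apply m A x = z *s vec_power x (m - 1)"
    and max: "\<And>j. cmod (x $ j) \<le> cmod (x $ t)" and "x $ t \<noteq> 0"
  shows "z \<in> K_set m A t p"
proof -
  define X Y where "X = cmod (x $ t) ^ (m - 1)" and "Y = cmod (x $ p) ^ (m - 1)"
  let ?u = "cmod (z - diag_entry m A t)" and ?v = "cmod (z - diag_entry m A p)"
  let ?b = "cmod (pair_entry m A t p)" and ?c = "cmod (pair_entry m A p t)"
  have "X > 0"
    using \<open>x $ t \<noteq> 0\<close> by (simp add: X_def)
  have "?u * X - ?b * Y \<le> row_sum_except m A t p * X"
    using order_trans[OF norm_triangle_ineq2 eigenvector_two_term_bound[OF m pt eig max]]
    by (simp add: norm_mult norm_power X_def Y_def)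
  then have row_t: "(?u - row_sum_except m A t p) * X \<le> ?b * Y"
    by (simp add: algebra_simps)
  have "?v * Y - ?c * X \<le> row_sum_except m A p t * X"
    using order_trans[OF norm_triangle_ineq2 eigenvector_two_term_bound[OF m pt[symmetric] eig max]]
    by (simp add: norm_mult norm_power X_def Y_def)
  then have row_p: "?v * Y \<le> row_sum m A p * X"
    by (simp add: row_sum_except_def algebra_simps)
  have "((?u - row_sum_except m A t p) * ?v) * X \<le> ?b * (?v * Y)"
    using mult_left_mono[OF row_t, of ?v] by (simp add: mult_ac)
  also have "\<dots> \<le> (?b * row_sum m A p) * X"
    using mult_left_mono[OF row_p, of ?b] by (simp add: mult_ac)
  finally show ?thesis
    using \<open>X > 0\<close> by (simp add: K_set_def)
qed

text \<open>
  Here the off-diagonal terms are isolated instead.  Row \<open>p\<close> bounds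
  \<open>\<bar>z - a\<^sub>p\<^sub>\<dots>\<^sub>p\<bar> \<bar>x\<^sub>p\<bar>\<^sup>m\<^sup>-\<^sup>1\<close> from below; the factor \<open>2\<close> in the definition of \<open>\<Lambda>\<^sub>t\<^sub>p\<close> arises because
  \<open>\<bar>a\<^sub>p\<^sub>t\<^sub>\<dots>\<^sub>t\<bar> - r\<^sub>p\<^sup>t = 2 \<bar>a\<^sub>p\<^sub>t\<^sub>\<dots>\<^sub>t\<bar> - r\<^sub>p\<close>.  Row \<open>t\<close> bounds
  \<open>\<bar>a\<^sub>t\<^sub>p\<^sub>\<dots>\<^sub>p\<bar> \<bar>x\<^sub>p\<bar>\<^sup>m\<^sup>-\<^sup>1\<close> from above.
\<close>

lemma not_Lambda_pair_of_maximal_index: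
  fixes x :: "complex ^ 'n::finite"
  assumes m: "m \<ge> 2" and pt: "p \<noteq> t"
    and eig: "tensor_apply m A x = z *s vec_power x (m - 1)"
    and max: "\<And>j. cmod (x $ j) \<le> cmod (x $ t)" and "x $ t \<noteq> 0"
  shows "z \<notin> Lambda_pair m A t p"
proof -
  define X Y where "X = cmod (x $ t) ^ (m - 1)" and "Y = cmod (x $ p) ^ (m - 1)"
  let ?u = "cmod (z - diag_entry m A t)" and ?v = "cmod (z - diag_entry m A p)"
  let ?b = "cmod (pair_entry m A t p)" and ?c = "cmod (pair_entry m A p t)"
  have "X > 0"
    using \<open>x $ t \<noteq> 0\<close> by (simp add: X_def)
  have "?b * Y - ?u * X \<le> row_sum_except m A t p * X"
    using abs_le_D2[OF order_trans[OF norm_triangle_ineq3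
        eigenvector_two_term_bound[OF m pt eig max]]]
    by (simp add: norm_mult norm_power X_def Y_def)
  then have row_t: "?b * Y \<le> (?u + row_sum_except m A t p) * X"
    by (simp add: algebra_simps)
  have "?c * X - ?v * Y \<le> row_sum_except m A p t * X"
    using abs_le_D2[OF order_trans[OF norm_triangle_ineq3
        eigenvector_two_term_bound[OF m pt[symmetric] eig max]]]
    by (simp add: norm_mult norm_power X_def Y_def)
  then have row_p: "(2 * ?c - row_sum m A p) * X \<le> ?v * Y"
    by (simp add: row_sum_except_def algebra_simps)
  have "(?b * (2 * ?c - row_sum m A p)) * X \<le> ?v * (?b * Y)"
    using mult_left_mono[OF row_p, of ?b] by (simp add: mult_ac)
  also have "\<dots> \<le> ((?u + row_sum_except m A t p) * ?v) * X"
    using mult_left_mono[OF row_t, of ?v] by (simp add: mult_ac)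
  finally show ?thesis
    using \<open>X > 0\<close> by (simp add: Lambda_pair_def not_less)
qed

lemma exists_maximal_modulus_index:
  fixes x :: "complex ^ 'n::finite"
  assumes "x \<noteq> 0"
  obtains t where "x $ t \<noteq> 0" and "\<And>j. cmod (x $ j) \<le> cmod (x $ t)"
proof -
  have "Max (range (\<lambda>j. cmod (x $ j))) \<in> range (\<lambda>j. cmod (x $ j))"
    by (rule Max_in) auto
  then obtain t where t: "Max (range (\<lambda>j. cmod (x $ j))) = cmod (x $ t)"
    by blast
  have max: "cmod (x $ j) \<le> cmod (x $ t)" for j
    unfolding t[symmetric] by (rule Max_ge) auto
  moreover have "x $ t \<noteq> 0"
  proof
    assume "x $ t = 0"
    with max have "x $ j = 0" for j
      by (metis norm_le_zero_iff norm_zero)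
    with \<open>x \<noteq> 0\<close> show False
      by (simp add: vec_eq_iff)
  qed
  ultimately show thesis
    by (rule that[rotated])
qed

theorem theorem4:
  fixes m :: nat and A :: "'n::finite tensor"
  assumes "m \<ge> 2" and "CARD('n) \<ge> 2"
  shows "tensor_spectrum m A \<subseteq> Theta_region m A \<and> Theta_region m A \<subseteq> K_region m A"
proof
  show "tensor_spectrum m A \<subseteq> Theta_region m A"
  proof
    fix z assume "z \<in> tensor_spectrum m A"
    then obtain x where "x \<noteq> 0" and eig: "tensor_apply m A x = z *s vec_power x (m - 1)"
      by (auto simp: tensor_spectrum_def tensor_eigenvalue_def)
    from \<open>x \<noteq> 0\<close> obtain t where t: "x $ t \<noteq> 0" "\<And>j. cmod (x $ j) \<le> cmod (x $ t)"
      by (rule exists_maximal_modulus_index) blast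
    have "UNIV \<noteq> {t}"
      using assms(2) by (metis card.empty card.insert empty_iff finite.emptyI not_less_eq_eq
          numeral_2_eq_2 order_refl)
    then obtain j where "j \<noteq> t"
      by blast
    have "z \<in> K_set m A t j"
      using K_set_of_maximal_index[OF assms(1) \<open>j \<noteq> t\<close> eig t(2,1)] .
    moreover have "z \<notin> Lambda_set m A t"
      using not_Lambda_pair_of_maximal_index[OF assms(1) _ eig t(2,1)]
      by (auto simp: Lambda_set_def)
    ultimately show "z \<in> Theta_region m A"
      using \<open>j \<noteq> t\<close> by (auto simp: Theta_region_def Theta_pair_def)
  qed
  show "Theta_region m A \<subseteq> K_region m A"
    by (auto simp: Theta_region_def K_region_def Theta_pair_def)
qed

end
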